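(* Let $a<b$, $c<d$, let $q>1$ and let $p$ be defined by $\frac1p+\frac1q=1$. Let $f:\Delta=[a,b]\times[c,d]\to\mathbb{R}$ be a partially differentiable mapping on $\Delta$. If $\left|\frac{\partial^2 f}{\partial t\partial s}\right|^q$ is a convex function on the co-ordinates on $\Delta$, then $$\left|f\left(\frac{a+b}{2},\frac{c+d}{2}\right)+\frac{1}{(b-a)(d-c)}\int_a^b\int_c^d f(x,y)\,dy\,dx-\frac{1}{d-c}\int_c^d f\left(\frac{a+b}{2},y\right)dy-\frac{1}{b-a}\int_a^b f\left(x,\frac{c+d}{2}\right)dx\right|$$ $$\le\frac{(b-a)(d-c)}{4(p+1)^{\frac2p}}\left(\frac{\left|\frac{\partial^2 f}{\partial t\partial s}(a,c)\right|^q+\left|\frac{\partial^2 f}{\partial t\partial s}(b,c)\right|^q+\left|\frac{\partial^2 f}{\partial t\partial s}(a,d)\right|^q+\left|\frac{\partial^2 f}{\partial t\partial s}(b,d)\right|^q}{4}\right)^{\frac1q}.$$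
   Context: $\frac{\partial^2 f}{\partial t\partial s}$ denotes the second-order mixed partial derivative of $f$ with respect to its first variable ($t$) and its second variable ($s$), on $\Delta$. A function $g:\Delta=[a,b]\times[c,d]\to\mathbb{R}$ is called convex on the co-ordinates on $\Delta$ if for every $y\in[c,d]$ the partial mapping $g_y:[a,b]\to\mathbb{R}$, $g_y(u)=g(u,y)$, is convex, and for every $x\in[a,b]$ the partial mapping $g_x:[c,d]\to\mathbb{R}$, $g_x(v)=g(x,v)$, is convex. *)

theory Defs
  imports "HOL-Analysis.Analysis"
begin

text \<open>
  Partial derivatives of a real function on a product of real intervals \<open>I \<times> J\<close>. They are taken
  within \<open>I\<close> (respectively \<open>J\<close>), so they are one-sided at the boundary and depend only on the
  values of \<open>f\<close> on \<open>I \<times> J\<close>. Where the derivative does not exist, the value is unspecified.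
\<close>

definition partial_fst :: "real set \<Rightarrow> (real \<times> real \<Rightarrow> real) \<Rightarrow> real \<times> real \<Rightarrow> real" where
  "partial_fst I f = (\<lambda>(t, s). vector_derivative (\<lambda>u. f (u, s)) (at t within I))"

definition partial_snd :: "real set \<Rightarrow> (real \<times> real \<Rightarrow> real) \<Rightarrow> real \<times> real \<Rightarrow> real" where
  "partial_snd J f = (\<lambda>(t, s). vector_derivative (\<lambda>v. f (t, v)) (at s within J))"

definition partially_differentiable_fst_on ::
    "(real \<times> real \<Rightarrow> real) \<Rightarrow> real set \<Rightarrow> real set \<Rightarrow> bool" where
  "partially_differentiable_fst_on f I J \<longleftrightarrow>
     (\<forall>t\<in>I. \<forall>s\<in>J. (\<lambda>u. f (u, s)) differentiable (at t within I))"

definition partially_differentiable_snd_on ::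
    "(real \<times> real \<Rightarrow> real) \<Rightarrow> real set \<Rightarrow> real set \<Rightarrow> bool" where
  "partially_differentiable_snd_on f I J \<longleftrightarrow>
     (\<forall>t\<in>I. \<forall>s\<in>J. (\<lambda>v. f (t, v)) differentiable (at s within J))"

text \<open>The mixed derivative is \<open>\<partial>/\<partial>t (\<partial>f/\<partial>s)\<close>: first in \<open>s\<close>, then in \<open>t\<close>.\<close>

definition mixed_partial ::
    "real set \<Rightarrow> real set \<Rightarrow> (real \<times> real \<Rightarrow> real) \<Rightarrow> real \<times> real \<Rightarrow> real" where
  "mixed_partial I J f = partial_fst I (partial_snd J f)"

definition coordinated_convex_on ::
    "real set \<Rightarrow> real set \<Rightarrow> (real \<times> real \<Rightarrow> real) \<Rightarrow> bool" where
  "coordinated_convex_on I J g \<longleftrightarrow>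
     (\<forall>y\<in>J. convex_on I (\<lambda>u. g (u, y))) \<and> (\<forall>x\<in>I. convex_on J (\<lambda>v. g (x, v)))"

end

theory Submission
  imports Defs
begin

text \<open>
  Joint measurability of the mixed derivative \<open>g\<close> is not evident, so no integral identity
  for \<open>g\<close> is used. Instead, convexity on the co-ordinates gives \<open>\<bar>g\<bar> \<le> B powr (1 / q)\<close>, where
  \<open>B\<close> interpolates the corner values of \<open>\<bar>g\<bar> powr q\<close> bilinearly, and this majorant is continuous.
  If the increments of \<open>\<phi>\<close> are bounded by the integrals of a continuous \<open>\<psi>\<close>, then
  \<open>\<bar>(b - a) * \<phi> ((a + b) / 2) - \<integral>\<phi>\<bar>\<close> is at most the integral of \<open>\<psi>\<close> against the tent function
  \<open>min (t - a) (b - t)\<close>. Applied once in each variable, this bounds the left-hand side by the integral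
  of \<open>B powr (1 / q)\<close> against a product of two tents. Hoelder's inequality, in the form
  of an integrated Young inequality, then gives the constant.
\<close>

section \<open>Midpoint rule in one variable with a tent kernel\<close>

text \<open>The integral is the gauge integral, so the fundamental theorem makes any derivative
  integrable; \<open>h'\<close> may be discontinuous, and only its majorant \<open>\<psi>\<close> is
  continuous.\<close>

lemma increment_le_integral:
  fixes h \<psi> :: "real \<Rightarrow> real"
  assumes der: "\<And>t. t \<in> {a..b} \<Longrightarrow> (h has_vector_derivative h' t) (at t within {a..b})"
    and cont: "continuous_on {a..b} \<psi>"
    and bound: "\<And>t. t \<in> {a..b} \<Longrightarrow> \<bar>h' t\<bar> \<le> \<psi> t"
    and xy: "a \<le> x" "x \<le> y" "y \<le> b"
  shows "\<bar>h y - h x\<bar> \<le> integral {x..y} \<psi>"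
proof -
  have sub: "{x..y} \<subseteq> {a..b}" using xy by auto
  have ftc: "(h' has_integral (h y - h x)) {x..y}"
    using xy(2) sub
    by (intro fundamental_theorem_of_calculus)
       (auto intro: has_vector_derivative_within_subset[OF der])
  have "norm (integral {x..y} h') \<le> integral {x..y} \<psi>"
    using ftc sub bound cont
    by (intro integral_norm_bound_integral has_integral_integrable[OF ftc]
        integrable_continuous_real) (auto intro: continuous_on_subset)
  then show ?thesis
    using integral_unique[OF ftc] by simp
qed

text \<open>On \<open>{a..b}\<close> this is the distance to the nearer endpoint, that is, the
  absolute value of the Peano kernel of the midpoint rule.\<close>

definition tent :: "real \<Rightarrow> real \<Rightarrow> real \<Rightarrow> real" where
  "tent a b t = min (t - a) (b - t)"

lemma continuous_on_tent [continuous_intros]: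
  "continuous_on S f \<Longrightarrow> continuous_on S (\<lambda>x. tent a b (f x))"
  unfolding tent_def by (intro continuous_intros)

lemma tent_nonneg: "t \<in> {a..b} \<Longrightarrow> 0 \<le> tent a b t"
  by (simp add: tent_def)

text \<open>The deviation is the integral of \<open>\<phi> m - \<phi> t\<close>, which is dominated
  by the increments of a primitive \<open>\<Psi>\<close> of \<open>\<psi>\<close>; integration by
  parts on each half turns these into the tent weight. An increment bound in place of a derivative
  bound lets \<open>\<phi>\<close> be a parameter integral that is not known to be
  differentiable.\<close>

lemma midpoint_deviation_le:
  fixes \<phi> \<psi> :: "real \<Rightarrow> real"
  assumes "a < b"
    and contp: "continuous_on {a..b} \<phi>" and cont: "continuous_on {a..b} \<psi>"
    and bound: "\<And>x y. a \<le> x \<Longrightarrow> x \<le> y \<Longrightarrow> y \<le> b \<Longrightarrow> \<bar>\<phi> y - \<phi> x\<bar> \<le> integral {x..y} \<psi>"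
  shows "\<bar>(b - a) * \<phi> ((a + b) / 2) - integral {a..b} \<phi>\<bar>
           \<le> integral {a..b} (\<lambda>t. tent a b t * \<psi> t)"
proof -
  define m where "m = (a + b) / 2"
  define \<Psi> where "\<Psi> t = integral {a..t} \<psi>" for t
  have m: "a \<le> m" "m \<le> b" using \<open>a < b\<close> by (auto simp: m_def)
  have der: "(\<Psi> has_real_derivative \<psi> t) (at t within {a..b})" if "t \<in> {a..b}" for t
    using integral_has_real_derivative[OF cont that] by (simp add: \<Psi>_def[abs_def])
  have contP: "continuous_on {a..b} \<Psi>"
    by (meson der has_field_derivative_imp_has_derivative has_derivative_continuous_on)
  have bnd: "\<bar>\<phi> y - \<phi> x\<bar> \<le> \<Psi> y - \<Psi> x" if "a \<le> x" "x \<le> y" "y \<le> b" for x y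
  proof -
    have "integral {a..x} \<psi> + integral {x..y} \<psi> = integral {a..y} \<psi>"
      using that by (intro Henstock_Kurzweil_Integration.integral_combine integrable_continuous_real
          continuous_on_subset[OF cont]) auto
    then show ?thesis using bound[OF that] by (simp add: \<Psi>_def)
  qed
  have iphi: "\<phi> integrable_on {u..v}" if "a \<le> u" "v \<le> b" for u v
    using that by (intro integrable_continuous_real continuous_on_subset[OF contp]) auto
  have iPsi: "\<Psi> integrable_on {u..v}" if "a \<le> u" "v \<le> b" for u v
    using that by (intro integrable_continuous_real continuous_on_subset[OF contP]) auto
  have ipsi: "(\<lambda>t. tent a b t * \<psi> t) integrable_on {u..v}" if "a \<le> u" "v \<le> b" for u v
    using that by (intro integrable_continuous_real continuous_intros
        continuous_on_subset[OF cont]) auto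
  have left: "\<bar>integral {a..m} (\<lambda>t. \<phi> m - \<phi> t)\<bar> \<le> integral {a..m} (\<lambda>t. tent a b t * \<psi> t)"
  proof -
    \<comment> \<open>Integration by parts: the integrand is the derivative of
      \<open>(t - a) * (\<Psi> m - \<Psi> t)\<close>, which vanishes at both ends.\<close>
    have I0: "((\<lambda>t. (\<Psi> m - \<Psi> t) - (t - a) * \<psi> t) has_integral
            ((m - a) * (\<Psi> m - \<Psi> m) - (a - a) * (\<Psi> m - \<Psi> a))) {a..m}"
      using m
      by (intro fundamental_theorem_of_calculus)
         (auto simp flip: has_real_derivative_iff_has_vector_derivative
           intro!: derivative_eq_intros has_field_derivative_subset[OF der])
    have eq: "\<Psi> m - \<Psi> t - (t - a) * \<psi> t = \<Psi> m - \<Psi> t - tent a b t * \<psi> t"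
      if "t \<in> {a..m}" for t
      using that by (auto simp: tent_def m_def min_def)
    have "((\<lambda>t. (\<Psi> m - \<Psi> t) - tent a b t * \<psi> t) has_integral 0) {a..m}"
      using has_integral_eq[OF eq I0] by simp
    from has_integral_add[OF this integrable_integral[OF ipsi[of a m]]] m
    have I: "((\<lambda>t. \<Psi> m - \<Psi> t) has_integral integral {a..m} (\<lambda>t. tent a b t * \<psi> t)) {a..m}"
      by simp
    have "norm (integral {a..m} (\<lambda>t. \<phi> m - \<phi> t)) \<le> integral {a..m} (\<lambda>t. \<Psi> m - \<Psi> t)"
      using m by (intro integral_norm_bound_integral has_integral_integrable[OF I]
          integrable_diff iphi integrable_const_ivl) (auto intro: bnd)
    then show ?thesis using integral_unique[OF I] by simp
  qed
  have right: "\<bar>integral {m..b} (\<lambda>t. \<phi> m - \<phi> t)\<bar> \<le> integral {m..b} (\<lambda>t. tent a b t * \<psi> t)"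
  proof -
    \<comment> \<open>The antiderivative is now \<open>(b - t) * (\<Psi> m - \<Psi> t)\<close>,
      again zero at both ends.\<close>
    have I0: "((\<lambda>t. (\<Psi> t - \<Psi> m) - (b - t) * \<psi> t) has_integral
            ((b - b) * (\<Psi> m - \<Psi> b) - (b - m) * (\<Psi> m - \<Psi> m))) {m..b}"
      using m
      by (intro fundamental_theorem_of_calculus)
         (auto simp flip: has_real_derivative_iff_has_vector_derivative
           intro!: derivative_eq_intros has_field_derivative_subset[OF der])
    have eq: "\<Psi> t - \<Psi> m - (b - t) * \<psi> t = \<Psi> t - \<Psi> m - tent a b t * \<psi> t"
      if "t \<in> {m..b}" for t
      using that by (auto simp: tent_def m_def min_def)
    have "((\<lambda>t. (\<Psi> t - \<Psi> m) - tent a b t * \<psi> t) has_integral 0) {m..b}"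
      using has_integral_eq[OF eq I0] by simp
    from has_integral_add[OF this integrable_integral[OF ipsi[of m b]]] m
    have I: "((\<lambda>t. \<Psi> t - \<Psi> m) has_integral integral {m..b} (\<lambda>t. tent a b t * \<psi> t)) {m..b}"
      by simp
    have "norm (integral {m..b} (\<lambda>t. \<phi> m - \<phi> t)) \<le> integral {m..b} (\<lambda>t. \<Psi> t - \<Psi> m)"
      using m by (intro integral_norm_bound_integral has_integral_integrable[OF I]
          integrable_diff iphi integrable_const_ivl)
        (auto simp: abs_minus_commute[of "\<phi> m"] intro: bnd)
    then show ?thesis using integral_unique[OF I] by simp
  qed
  have "(b - a) * \<phi> m - integral {a..b} \<phi> = integral {a..b} (\<lambda>t. \<phi> m - \<phi> t)"
    using \<open>a < b\<close> iphi by (subst integral_diff) auto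
  also have "\<dots> = integral {a..m} (\<lambda>t. \<phi> m - \<phi> t) + integral {m..b} (\<lambda>t. \<phi> m - \<phi> t)"
    using m by (intro Henstock_Kurzweil_Integration.integral_combine[symmetric] integrable_diff iphi integrable_const_ivl) auto
  finally have "\<bar>(b - a) * \<phi> m - integral {a..b} \<phi>\<bar>
      \<le> integral {a..m} (\<lambda>t. tent a b t * \<psi> t) + integral {m..b} (\<lambda>t. tent a b t * \<psi> t)"
    using left right by linarith
  also have "\<dots> = integral {a..b} (\<lambda>t. tent a b t * \<psi> t)"
    using m by (intro Henstock_Kurzweil_Integration.integral_combine ipsi) auto
  finally show ?thesis by (simp add: m_def)
qed

section \<open>Power moments of the tent\<close>

text \<open>By symmetry both halves contribute the same \<open>J\<close>. Used once per variable,
  this moment produces the 4 and the \<open>(p + 1) powr (2 / p)\<close> of the final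
  constant.\<close>

lemma has_integral_tent_powr:
  fixes p :: real
  assumes "a < b" "p > 0"
  shows "((\<lambda>t. tent a b t powr p) has_integral (b - a) * ((b - a) / 2) powr p / (p + 1)) {a..b}"
proof -
  define m where "m = (a + b) / 2"
  have m: "a \<le> m" "m \<le> b" "m - a = (b - a) / 2" "b - m = (b - a) / 2"
    using \<open>a < b\<close> by (auto simp: m_def field_simps)
  define J where "J = ((b - a) / 2) powr (p + 1) / (p + 1)"
  \<comment> \<open>The base vanishes at \<open>t = a\<close>, where the power rule for
    \<open>powr\<close> does not apply; hence derivatives in the interior and mere continuity at the
    ends.\<close>
  have "((\<lambda>t. (t - a) powr p) has_integral
          ((m - a) powr (p + 1) / (p + 1) - (a - a) powr (p + 1) / (p + 1))) {a..m}"
    using m \<open>p > 0\<close>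
    by (intro fundamental_theorem_of_calculus_interior)
       (auto simp flip: has_real_derivative_iff_has_vector_derivative
         intro!: derivative_eq_intros continuous_intros continuous_on_powr')
  then have "((\<lambda>t. (t - a) powr p) has_integral J) {a..m}"
    using \<open>p > 0\<close> m(3) by (simp add: J_def)
  then have l: "((\<lambda>t. tent a b t powr p) has_integral J) {a..m}"
    by (rule has_integral_eq[rotated]) (auto simp: tent_def m_def min_def)
  have "((\<lambda>t. (b - t) powr p) has_integral
          (- ((b - b) powr (p + 1) / (p + 1)) - - ((b - m) powr (p + 1) / (p + 1)))) {m..b}"
    using m \<open>p > 0\<close>
    by (intro fundamental_theorem_of_calculus_interior)
       (auto simp flip: has_real_derivative_iff_has_vector_derivative
         intro!: derivative_eq_intros continuous_intros continuous_on_powr')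
  then have "((\<lambda>t. (b - t) powr p) has_integral J) {m..b}"
    using \<open>p > 0\<close> m(4) by (simp add: J_def)
  then have r: "((\<lambda>t. tent a b t powr p) has_integral J) {m..b}"
  proof (rule has_integral_eq[rotated])
    show "(b - t) powr p = tent a b t powr p" if "t \<in> {m..b}" for t
      using that by (intro arg_cong[where f = "\<lambda>x. x powr p"]) (auto simp: tent_def m_def min_def)
  qed
  have "J + J = (b - a) * ((b - a) / 2) powr p / (p + 1)"
    using \<open>a < b\<close> \<open>p > 0\<close> by (simp add: J_def powr_add divide_simps)
  then show ?thesis
    using has_integral_combine[OF m(1,2) l r] by simp
qed

section \<open>Bilinear interpolation of the corner values\<close>

text \<open>Written through the midpoint value, so that integrating the interpolant in either
  variable amounts to evaluating it at the centre.\<close>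

lemma has_integral_affine:
  fixes u v :: real
  assumes "a \<le> b"
  shows "((\<lambda>t. u * t + v) has_integral (b - a) * (u * ((a + b) / 2) + v)) {a..b}"
proof -
  have "((\<lambda>t. u * t + v) has_integral (u * b\<^sup>2 / 2 + v * b - (u * a\<^sup>2 / 2 + v * a))) {a..b}"
    using assms
    by (intro fundamental_theorem_of_calculus)
       (auto simp flip: has_real_derivative_iff_has_vector_derivative
         intro!: derivative_eq_intros)
  moreover have "u * b\<^sup>2 / 2 + v * b - (u * a\<^sup>2 / 2 + v * a) = (b - a) * (u * ((a + b) / 2) + v)"
    by (simp add: field_simps power2_eq_square)
  ultimately show ?thesis by simp
qed

text \<open>The corner values are listed in the order \<open>(a, c)\<close>, \<open>(b, c)\<close>, \<open>(a, d)\<close>, \<open>(b, d)\<close>.\<close>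

definition bilinear_interp ::
    "real \<Rightarrow> real \<Rightarrow> real \<Rightarrow> real \<Rightarrow> real \<times> real \<times> real \<times> real \<Rightarrow> real \<Rightarrow> real \<Rightarrow> real" where
  "bilinear_interp a b c d = (\<lambda>(\<alpha>, \<beta>, \<gamma>, \<delta>) t s.
     ((b - t) * ((d - s) * \<alpha> + (s - c) * \<gamma>) + (t - a) * ((d - s) * \<beta> + (s - c) * \<delta>))
       / ((b - a) * (d - c)))"

lemma bilinear_interp_nonneg:
  assumes "a < b" "c < d" "\<alpha> \<ge> 0" "\<beta> \<ge> 0" "\<gamma> \<ge> 0" "\<delta> \<ge> 0" "t \<in> {a..b}" "s \<in> {c..d}"
  shows "bilinear_interp a b c d (\<alpha>, \<beta>, \<gamma>, \<delta>) t s \<ge> 0"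
  using assms unfolding bilinear_interp_def
  by (auto intro!: divide_nonneg_nonneg add_nonneg_nonneg mult_nonneg_nonneg)

text \<open>Source of the corner average in the final bound: the interpolant is affine in each
  variable, so its mean over the rectangle is this central value.\<close>

lemma bilinear_interp_midpoint:
  assumes "a < b" "c < d"
  shows "bilinear_interp a b c d (\<alpha>, \<beta>, \<gamma>, \<delta>) ((a + b) / 2) ((c + d) / 2) = (\<alpha> + \<beta> + \<gamma> + \<delta>) / 4"
proof -
  have eqs: "b - (a + b) / 2 = (b - a) / 2" "(a + b) / 2 - a = (b - a) / 2"
    "d - (c + d) / 2 = (d - c) / 2" "(c + d) / 2 - c = (d - c) / 2"
    by (auto simp: field_simps)
  show ?thesis
    unfolding bilinear_interp_def prod.case eqs using assms
    by (simp add: divide_simps) (simp add: algebra_simps)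
qed

lemma has_integral_bilinear_interp_snd:
  assumes "c \<le> d"
  shows "(bilinear_interp a b c d v t has_integral
           (d - c) * bilinear_interp a b c d v t ((c + d) / 2)) {c..d}"
proof -
  obtain \<alpha> \<beta> \<gamma> \<delta> where v: "v = (\<alpha>, \<beta>, \<gamma>, \<delta>)" by (metis prod_cases4)
  have eq: "bilinear_interp a b c d v t = (\<lambda>s.
      ((b - t) * (\<gamma> - \<alpha>) + (t - a) * (\<delta> - \<beta>)) / ((b - a) * (d - c)) * s +
      ((b - t) * (d * \<alpha> - c * \<gamma>) + (t - a) * (d * \<beta> - c * \<delta>)) / ((b - a) * (d - c)))"
    unfolding v bilinear_interp_def prod.case
    by (rule ext) (simp add: add_divide_distrib[symmetric] algebra_simps)
  show ?thesis unfolding eq by (rule has_integral_affine[OF assms])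
qed

lemma has_integral_bilinear_interp_fst:
  assumes "a \<le> b"
  shows "((\<lambda>t. bilinear_interp a b c d v t s) has_integral
           (b - a) * bilinear_interp a b c d v ((a + b) / 2) s) {a..b}"
proof -
  obtain \<alpha> \<beta> \<gamma> \<delta> where v: "v = (\<alpha>, \<beta>, \<gamma>, \<delta>)" by (metis prod_cases4)
  have eq: "bilinear_interp a b c d v t s =
      (((d - s) * \<beta> + (s - c) * \<delta>) - ((d - s) * \<alpha> + (s - c) * \<gamma>)) / ((b - a) * (d - c)) * t +
      (b * ((d - s) * \<alpha> + (s - c) * \<gamma>) - a * ((d - s) * \<beta> + (s - c) * \<delta>)) / ((b - a) * (d - c))" for t
    unfolding v bilinear_interp_def prod.case
    by (simp add: add_divide_distrib[symmetric] algebra_simps)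
  show ?thesis unfolding eq by (rule has_integral_affine[OF assms])
qed

lemma convex_on_Icc_le_interp:
  fixes h :: "real \<Rightarrow> real"
  assumes "convex_on {a..b} h" "a < b" "t \<in> {a..b}"
  shows "h t \<le> ((b - t) * h a + (t - a) * h b) / (b - a)"
proof -
  define w where "w = (t - a) / (b - a)"
  have w: "w \<in> {0..1}" "1 - w = (b - t) / (b - a)"
    using assms by (auto simp: w_def field_simps)
  have "t = (1 - w) * a + w * b"
    using assms(2) by (simp add: w_def w(2) divide_simps) (simp add: algebra_simps)
  then have "h t \<le> (1 - w) * h a + w * h b"
    using convex_onD[OF assms(1), of w a b] w assms(2) by simp
  then show ?thesis by (simp add: w(2)) (simp add: w_def add_divide_distrib)
qed

text \<open>Convexity in the first variable along the line at height \<open>s\<close> reduces to the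
  edges \<open>a\<close> and \<open>b\<close>; convexity in the second variable on these two edges
  reduces to the corners.\<close>

lemma coordinated_convex_le_bilinear_interp:
  assumes "coordinated_convex_on {a..b} {c..d} h" "a < b" "c < d" "t \<in> {a..b}" "s \<in> {c..d}"
  shows "h (t, s) \<le> bilinear_interp a b c d (h (a, c), h (b, c), h (a, d), h (b, d)) t s"
proof -
  note ab = \<open>a < b\<close> and cd = \<open>c < d\<close>
  have conv: "convex_on {a..b} (\<lambda>u. h (u, s))" "convex_on {c..d} (\<lambda>v. h (a, v))"
    "convex_on {c..d} (\<lambda>v. h (b, v))"
    using assms by (auto simp: coordinated_convex_on_def)
  have "h (t, s) \<le> ((b - t) * h (a, s) + (t - a) * h (b, s)) / (b - a)"
    using convex_on_Icc_le_interp[OF conv(1)] assms by simp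
  also have "\<dots> \<le> ((b - t) * (((d - s) * h (a, c) + (s - c) * h (a, d)) / (d - c))
      + (t - a) * (((d - s) * h (b, c) + (s - c) * h (b, d)) / (d - c))) / (b - a)"
    using convex_on_Icc_le_interp[OF conv(2), of s] convex_on_Icc_le_interp[OF conv(3), of s] assms
    by (intro divide_right_mono add_mono mult_left_mono) auto
  also have "\<dots> = bilinear_interp a b c d (h (a, c), h (b, c), h (a, d), h (b, d)) t s"
    using ab cd by (simp add: bilinear_interp_def divide_simps)
  finally show ?thesis .
qed

text \<open>The composed arguments \<open>f\<close> and \<open>g\<close> cover both joint continuity
  on the rectangle and continuity of slices. Where the interpolant vanishes, continuity of the power
  rests on \<open>r > 0\<close>.\<close>

lemma continuous_on_bilinear_interp_powr:
  assumes "a < b" "c < d" "\<alpha> \<ge> 0" "\<beta> \<ge> 0" "\<gamma> \<ge> 0" "\<delta> \<ge> 0" "r > 0"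
    and "continuous_on S f" "continuous_on S g" "f ` S \<subseteq> {a..b}" "g ` S \<subseteq> {c..d}"
  shows "continuous_on S (\<lambda>x. bilinear_interp a b c d (\<alpha>, \<beta>, \<gamma>, \<delta>) (f x) (g x) powr r)"
proof (rule continuous_on_powr')
  show "continuous_on S (\<lambda>x. bilinear_interp a b c d (\<alpha>, \<beta>, \<gamma>, \<delta>) (f x) (g x))"
    unfolding bilinear_interp_def prod.case using assms
    by (intro continuous_intros) auto
qed (use assms in \<open>auto intro!: bilinear_interp_nonneg\<close>)

section \<open>Hoelder estimate of the weighted integral\<close>

text \<open>Young's inequality splits the integrand into a product of tent powers and a multiple of
  \<open>B\<close>, both of which have exact integrals.\<close>

lemma tent_integral_bilinear_interp_le:
  fixes a b c d p q \<alpha> \<beta> \<gamma> \<delta> :: real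
  defines "B \<equiv> bilinear_interp a b c d (\<alpha>, \<beta>, \<gamma>, \<delta>)"
  assumes ab: "a < b" and cd: "c < d" and q: "q > 1" and pq: "1 / p + 1 / q = 1"
    and nn: "\<alpha> \<ge> 0" "\<beta> \<ge> 0" "\<gamma> \<ge> 0" "\<delta> \<ge> 0"
  shows "integral {a..b} (\<lambda>t. tent a b t * integral {c..d} (\<lambda>s. tent c d s * B t s powr (1 / q)))
    \<le> (b - a) * (d - c) * ((b - a) * (d - c) / (4 * (p + 1) powr (2 / p))
         * ((\<alpha> + \<beta> + \<gamma> + \<delta>) / 4) powr (1 / q))"
proof (cases "\<alpha> + \<beta> + \<gamma> + \<delta> = 0")
  \<comment> \<open>Here \<open>S\<close> would be 0 and could not serve as a normalising divisor;
    the interpolant is identically 0.\<close>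
  case True
  then have z: "\<alpha> = 0" "\<beta> = 0" "\<gamma> = 0" "\<delta> = 0" using nn by auto
  show ?thesis by (simp add: B_def bilinear_interp_def z)
next
  case False
  define M where "M = (\<alpha> + \<beta> + \<gamma> + \<delta>) / 4"
  define S where "S = M powr (1 / q)"
  \<comment> \<open>\<open>k\<close> and \<open>S\<close> are the normalised \<open>L\<^sup>p\<close> norm of the product of tents and \<open>L\<^sup>q\<close> norm of
      \<open>B powr (1 / q)\<close>, the scaling at which Young's inequality integrates to Hoelder's.\<close>
  define k where "k = (b - a) * (d - c) / (4 * (p + 1) powr (2 / p))"
  have "1 / q < 1" using q by simp
  then have "1 / p > 0" using pq by linarith
  then have p0: "p > 0" by simp
  have "1 / q > 0" using q by simp
  then have "1 / p < 1" using pq by linarith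
  then have p: "p > 1" using p0 by simp
  have M: "M > 0" using False nn by (simp add: M_def)
  have S: "S > 0" "S powr q = M" using M q by (auto simp: S_def powr_powr)
  have k: "k > 0" using ab cd p by (simp add: k_def)
  \<comment> \<open>\<open>k powr p\<close> is the product of the mean values of the two tent
    powers, with one factor \<open>p + 1\<close> from each variable.\<close>
  have kp: "k powr p = ((b - a) / 2) powr p * ((d - c) / 2) powr p / (p + 1)\<^sup>2"
  proof -
    have "k = ((b - a) / 2) * ((d - c) / 2) / (p + 1) powr (2 / p)"
      by (simp add: k_def)
    then show ?thesis
      using ab cd p powr_mult[of 2 2 p] by (simp add: powr_divide powr_mult powr_powr)
  qed
  have B_nn: "B t s \<ge> 0" if "t \<in> {a..b}" "s \<in> {c..d}" for t s
    unfolding B_def using bilinear_interp_nonneg[OF ab cd nn that] .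
  \<comment> \<open>\<open>u\<close> and \<open>v\<close> are the coefficients left after
    multiplying the normalised Young inequality by \<open>k * S\<close>.\<close>
  define u where "u = k * S / (p * k powr p)"
  define v where "v = k * S / (q * M)"
  have young: "tent a b t * (tent c d s * B t s powr (1 / q))
      \<le> u * tent a b t powr p * tent c d s powr p + v * B t s"
    if "t \<in> {a..b}" "s \<in> {c..d}" for t s
  proof -
    have nn': "tent a b t \<ge> 0" "tent c d s \<ge> 0" using that by (auto intro: tent_nonneg)
    have "(tent a b t * tent c d s / k) * (B t s powr (1 / q) / S)
        \<le> (tent a b t * tent c d s / k) powr p / p + (B t s powr (1 / q) / S) powr q / q"
      using p q pq k S nn' B_nn[OF that]
      by (intro Youngs_inequality) auto
    also have "\<dots> = tent a b t powr p * tent c d s powr p / k powr p / p + B t s / M / q"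
      using nn' k S q B_nn[OF that] by (simp add: powr_divide powr_mult powr_powr)
    finally have "k * S * ((tent a b t * tent c d s / k) * (B t s powr (1 / q) / S))
        \<le> k * S * (tent a b t powr p * tent c d s powr p / k powr p / p + B t s / M / q)"
      using k S by (intro mult_left_mono) auto
    then show ?thesis
      using k S M by (simp add: u_def v_def field_simps)
  qed
  define J where "J = (d - c) * ((d - c) / 2) powr p / (p + 1)"
  have cont: "continuous_on ({a..b} \<times> {c..d}) (\<lambda>(t, s). tent c d s * B t s powr (1 / q))"
    unfolding B_def case_prod_unfold using q
    by (intro continuous_intros continuous_on_bilinear_interp_powr[OF ab cd nn]) auto
  have conti: "continuous_on {a..b} (\<lambda>t. integral {c..d} (\<lambda>s. tent c d s * B t s powr (1 / q)))"
    using integral_continuous_on_param[of "{a..b}" c d "\<lambda>t s. tent c d s * B t s powr (1 / q)"]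
      cont by simp
  \<comment> \<open>Integrating over \<open>s\<close> leaves a tent power plus an affine function of
    \<open>t\<close>, so the same two integral formulas apply again in \<open>t\<close>.\<close>
  have inner: "tent a b t * integral {c..d} (\<lambda>s. tent c d s * B t s powr (1 / q))
      \<le> u * J * tent a b t powr p + v * (d - c) * B t ((c + d) / 2)" if t: "t \<in> {a..b}" for t
  proof -
    have R: "((\<lambda>s. u * tent a b t powr p * tent c d s powr p + v * B t s) has_integral
        (u * tent a b t powr p * J + v * ((d - c) * B t ((c + d) / 2)))) {c..d}"
      unfolding J_def B_def using cd p0
      by (intro has_integral_add has_integral_mult_right has_integral_tent_powr
          has_integral_bilinear_interp_snd) auto
    have "continuous_on {c..d} (\<lambda>s. tent a b t * (tent c d s * B t s powr (1 / q)))"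
      unfolding B_def using q t
      by (intro continuous_intros continuous_on_bilinear_interp_powr[OF ab cd nn]) auto
    then have "integral {c..d} (\<lambda>s. tent a b t * (tent c d s * B t s powr (1 / q)))
        \<le> integral {c..d} (\<lambda>s. u * tent a b t powr p * tent c d s powr p + v * B t s)"
      using young[OF t]
      by (intro integral_le has_integral_integrable[OF R] integrable_continuous_real) auto
    then show ?thesis using integral_unique[OF R] by (simp add: algebra_simps)
  qed
  have R: "((\<lambda>t. u * J * tent a b t powr p + v * (d - c) * B t ((c + d) / 2)) has_integral
      (u * J * ((b - a) * ((b - a) / 2) powr p / (p + 1)) +
       v * (d - c) * ((b - a) * B ((a + b) / 2) ((c + d) / 2)))) {a..b}"
    unfolding B_def using ab p0
    by (intro has_integral_add has_integral_mult_right has_integral_tent_powr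
        has_integral_bilinear_interp_fst) auto
  have "integral {a..b} (\<lambda>t. tent a b t * integral {c..d} (\<lambda>s. tent c d s * B t s powr (1 / q)))
     \<le> integral {a..b} (\<lambda>t. u * J * tent a b t powr p + v * (d - c) * B t ((c + d) / 2))"
    using inner
    by (intro integral_le has_integral_integrable[OF R] integrable_continuous_real
        continuous_intros conti) auto
  also have "\<dots> = u * J * ((b - a) * ((b - a) / 2) powr p / (p + 1)) + v * (d - c) * ((b - a) * M)"
    using integral_unique[OF R] bilinear_interp_midpoint[OF ab cd] by (simp add: B_def M_def)
  \<comment> \<open>The scaling pays off: the two terms are the fractions \<open>1 / p\<close> and
    \<open>1 / q\<close> of the claimed bound.\<close>
  also have "u * J * ((b - a) * ((b - a) / 2) powr p / (p + 1))
      = u * ((b - a) * (d - c)) * k powr p"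
    by (simp add: J_def kp power2_eq_square)
  also have "\<dots> = (b - a) * (d - c) * (k * S) * (1 / p)"
    using k by (simp add: u_def)
  also have "v * (d - c) * ((b - a) * M) = (b - a) * (d - c) * (k * S) * (1 / q)"
    using M by (simp add: v_def)
  also have "(b - a) * (d - c) * (k * S) * (1 / p) + (b - a) * (d - c) * (k * S) * (1 / q)
      = (b - a) * (d - c) * (k * S)"
    using pq by (metis distrib_left mult.right_neutral)
  finally show ?thesis by (simp add: k_def S_def M_def)
qed

section \<open>Midpoint estimate in two variables\<close>

text \<open>The four-term expression is the deviation in \<open>t\<close> of \<open>\<phi>\<close>,
  itself the deviation of \<open>f\<close> in \<open>s\<close>. The one-variable estimate is used
  once for each, and the order of integration is exchanged only for the continuous majorant.\<close>

lemma midpoint_deviation_le2: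
  fixes f fs g :: "real \<times> real \<Rightarrow> real" and G :: "real \<Rightarrow> real \<Rightarrow> real"
  assumes ab: "a < b" and cd: "c < d"
    and contf: "\<And>s. s \<in> {c..d} \<Longrightarrow> continuous_on {a..b} (\<lambda>t. f (t, s))"
    and ders: "\<And>t s. t \<in> {a..b} \<Longrightarrow> s \<in> {c..d} \<Longrightarrow>
      ((\<lambda>v. f (t, v)) has_vector_derivative fs (t, s)) (at s within {c..d})"
    and dert: "\<And>t s. t \<in> {a..b} \<Longrightarrow> s \<in> {c..d} \<Longrightarrow>
      ((\<lambda>u. fs (u, s)) has_vector_derivative g (t, s)) (at t within {a..b})"
    and contG: "continuous_on ({a..b} \<times> {c..d}) (\<lambda>(t, s). G t s)"
    and bound: "\<And>t s. t \<in> {a..b} \<Longrightarrow> s \<in> {c..d} \<Longrightarrow> \<bar>g (t, s)\<bar> \<le> G t s"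
  shows "\<bar>(b - a) * (d - c) * f ((a + b) / 2, (c + d) / 2)
           + integral {a..b} (\<lambda>x. integral {c..d} (\<lambda>y. f (x, y)))
           - (b - a) * integral {c..d} (\<lambda>y. f ((a + b) / 2, y))
           - (d - c) * integral {a..b} (\<lambda>x. f (x, (c + d) / 2))\<bar>
    \<le> integral {a..b} (\<lambda>t. tent a b t * integral {c..d} (\<lambda>s. tent c d s * G t s))"
proof -
  define n where "n = (c + d) / 2"
  have n: "n \<in> {c..d}" using cd by (auto simp: n_def)
  define \<phi> where "\<phi> t = (d - c) * f (t, n) - integral {c..d} (\<lambda>y. f (t, y))" for t
  define \<psi> where "\<psi> t = integral {c..d} (\<lambda>s. tent c d s * G t s)" for t
  have contGt: "continuous_on {a..b} (\<lambda>t. G t s)" if "s \<in> {c..d}" for s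
  proof -
    have "continuous_on {a..b} (\<lambda>t. (\<lambda>(t, s). G t s) (t, s))"
      using that by (intro continuous_on_compose2[OF contG] continuous_intros) auto
    then show ?thesis by simp
  qed
  have contfs: "continuous_on {c..d} (\<lambda>s. f (t, s))" if "t \<in> {a..b}" for t
    by (rule continuous_on_vector_derivative[OF ders[OF that]])
  have cont\<psi>: "continuous_on {a..b} \<psi>"
    unfolding \<psi>_def[abs_def]
  proof -
    have "continuous_on ({a..b} \<times> cbox c d) (\<lambda>(t, s). tent c d s * G t s)"
      using contG by (auto simp: case_prod_unfold intro!: continuous_intros)
    then show "continuous_on {a..b} (\<lambda>t. integral {c..d} (\<lambda>s. tent c d s * G t s))"
      using integral_continuous_on_param[of "{a..b}" c d "\<lambda>t s. tent c d s * G t s"] by simp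
  qed
  have bnd: "\<bar>\<phi> y - \<phi> x\<bar> \<le> integral {x..y} \<psi>" if xy: "a \<le> x" "x \<le> y" "y \<le> b" for x y
  proof -
    define h where "h s = f (y, s) - f (x, s)" for s
    define \<eta> where "\<eta> s = integral {x..y} (\<lambda>t. G t s)" for s
    have xyin: "x \<in> {a..b}" "y \<in> {a..b}" "{x..y} \<subseteq> {a..b}" using xy by auto
    have contS: "continuous_on (cbox (c, x) (d, y)) (\<lambda>(s, t). tent c d s * G t s)"
    proof -
      have "continuous_on (cbox (c, x) (d, y)) (\<lambda>z. (\<lambda>(t, s). G t s) (snd z, fst z))"
        using xyin by (intro continuous_on_compose2[OF contG] continuous_intros)
           (auto simp: cbox_Pair_eq)
      then show ?thesis
        by (auto simp: case_prod_unfold intro!: continuous_intros)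
    qed
    have cont\<eta>: "continuous_on {c..d} \<eta>"
    proof -
      have "continuous_on ({c..d} \<times> cbox x y) (\<lambda>z. (\<lambda>(t, s). G t s) (snd z, fst z))"
        using xyin by (intro continuous_on_compose2[OF contG] continuous_intros) auto
      then show ?thesis
        unfolding \<eta>_def[abs_def]
        using integral_continuous_on_param[of "{c..d}" x y "\<lambda>s t. G t s"]
        by (auto simp: case_prod_unfold)
    qed
    have h': "(h has_vector_derivative fs (y, s) - fs (x, s)) (at s within {c..d})"
      if "s \<in> {c..d}" for s
      unfolding h_def[abs_def] using xyin that by (intro derivative_intros ders) auto
    \<comment> \<open>The increment lemma in \<open>t\<close> at fixed \<open>s\<close>: the mixed
      derivative enters only here, through its majorant \<open>G\<close>.\<close>
    have h'bound: "\<bar>fs (y, s) - fs (x, s)\<bar> \<le> \<eta> s" if "s \<in> {c..d}" for s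
      unfolding \<eta>_def using xy that
      by (intro increment_le_integral[OF dert[OF _ that] contGt[OF that] bound[OF _ that]]) auto
    have conth: "continuous_on {c..d} h"
      by (rule continuous_on_vector_derivative[OF h'])
    \<comment> \<open>The deviation in \<open>s\<close> is linear in the function, so this increment
      is the deviation of \<open>h\<close>.\<close>
    have "\<phi> y - \<phi> x = (d - c) * h ((c + d) / 2) - integral {c..d} h"
      using contfs[OF xyin(1)] contfs[OF xyin(2)] unfolding h_def \<phi>_def n_def
      by (subst integral_diff) (auto intro: integrable_continuous_real simp: algebra_simps)
    then have "\<bar>\<phi> y - \<phi> x\<bar> \<le> integral {c..d} (\<lambda>s. tent c d s * \<eta> s)"
      using midpoint_deviation_le[OF cd conth cont\<eta> increment_le_integral[OF h' cont\<eta> h'bound]]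
      by simp
    also have "\<dots> = integral {c..d} (\<lambda>s. integral {x..y} (\<lambda>t. tent c d s * G t s))"
      by (simp add: \<eta>_def)
    also have "\<dots> = integral {x..y} \<psi>"
      using integral_swap_continuous[OF contS] by (simp add: \<psi>_def[abs_def])
    finally show ?thesis .
  qed
  \<comment> \<open>Continuity of \<open>\<phi>\<close> comes from its increment bound; it also makes
      \<open>x \<mapsto> \<integral> f (x, y) dy\<close> integrable, as \<open>f\<close> is only assumed separately differentiable.\<close>
  have cont\<phi>: "continuous_on {a..b} \<phi>"
  proof -
    define \<Psi> where "\<Psi> t = integral {a..t} \<psi>" for t
    have contP: "continuous_on {a..b} \<Psi>"
      unfolding \<Psi>_def[abs_def]
      by (intro indefinite_integral_continuous_1 integrable_continuous_real cont\<psi>)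
    have le: "\<bar>\<phi> y - \<phi> x\<bar> \<le> \<bar>\<Psi> y - \<Psi> x\<bar>" if "a \<le> x" "x \<le> y" "y \<le> b" for x y
    proof -
      have "integral {a..x} \<psi> + integral {x..y} \<psi> = integral {a..y} \<psi>"
        using that by (intro Henstock_Kurzweil_Integration.integral_combine integrable_continuous_real
            continuous_on_subset[OF cont\<psi>]) auto
      then show ?thesis using bnd[OF that] by (simp add: \<Psi>_def)
    qed
    have le': "dist (\<phi> y) (\<phi> x) \<le> dist (\<Psi> y) (\<Psi> x)" if "x \<in> {a..b}" "y \<in> {a..b}" for x y
      using le[of x y] le[of y x] that by (cases "x \<le> y") (auto simp: dist_real_def)
    show ?thesis
      using contP le' unfolding continuous_on_iff by (meson le_less_trans)
  qed
  have iphi: "\<phi> integrable_on {a..b}"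
    by (intro integrable_continuous_real cont\<phi>)
  have ifn: "(\<lambda>t. (d - c) * f (t, n)) integrable_on {a..b}"
    by (intro integrable_continuous_real continuous_intros contf n)
  have "integral {a..b} (\<lambda>x. integral {c..d} (\<lambda>y. f (x, y)))
      = integral {a..b} (\<lambda>t. (d - c) * f (t, n) - \<phi> t)"
    by (simp add: \<phi>_def)
  also have "\<dots> = (d - c) * integral {a..b} (\<lambda>t. f (t, n)) - integral {a..b} \<phi>"
    using iphi ifn by (simp add: integral_diff)
  finally have "(b - a) * (d - c) * f ((a + b) / 2, n)
           + integral {a..b} (\<lambda>x. integral {c..d} (\<lambda>y. f (x, y)))
           - (b - a) * integral {c..d} (\<lambda>y. f ((a + b) / 2, y))
           - (d - c) * integral {a..b} (\<lambda>x. f (x, n))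
      = (b - a) * \<phi> ((a + b) / 2) - integral {a..b} \<phi>"
    by (simp add: \<phi>_def algebra_simps)
  then show ?thesis
    using midpoint_deviation_le[OF ab cont\<phi> cont\<psi> bnd] by (simp add: n_def \<psi>_def)
qed

section \<open>The inequality for co-ordinated convex mixed derivatives\<close>

theorem theorem8:
  fixes f :: "real \<times> real \<Rightarrow> real" and a b c d p q :: real
  defines "g \<equiv> mixed_partial {a..b} {c..d} f"
  assumes "a < b" and "c < d"
    and "q > 1" and "1 / p + 1 / q = 1"
    and "partially_differentiable_fst_on f {a..b} {c..d}"
    and "partially_differentiable_snd_on f {a..b} {c..d}"
    and "partially_differentiable_fst_on (partial_snd {c..d} f) {a..b} {c..d}"
    and "coordinated_convex_on {a..b} {c..d} (\<lambda>z. \<bar>g z\<bar> powr q)"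
  shows "\<bar>f ((a + b) / 2, (c + d) / 2)
           + 1 / ((b - a) * (d - c)) * integral {a..b} (\<lambda>x. integral {c..d} (\<lambda>y. f (x, y)))
           - 1 / (d - c) * integral {c..d} (\<lambda>y. f ((a + b) / 2, y))
           - 1 / (b - a) * integral {a..b} (\<lambda>x. f (x, (c + d) / 2))\<bar>
         \<le> (b - a) * (d - c) / (4 * (p + 1) powr (2 / p))
           * ((\<bar>g (a, c)\<bar> powr q + \<bar>g (b, c)\<bar> powr q
               + \<bar>g (a, d)\<bar> powr q + \<bar>g (b, d)\<bar> powr q) / 4) powr (1 / q)"
    (is "\<bar>?E\<bar> \<le> ?R")
proof -
  note ab = \<open>a < b\<close> and cd = \<open>c < d\<close>
  define B where "B = bilinear_interp a b c d
    (\<bar>g (a, c)\<bar> powr q, \<bar>g (b, c)\<bar> powr q, \<bar>g (a, d)\<bar> powr q, \<bar>g (b, d)\<bar> powr q)"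
  have bound: "\<bar>g (t, s)\<bar> \<le> B t s powr (1 / q)" if "t \<in> {a..b}" "s \<in> {c..d}" for t s
  proof -
    have "\<bar>g (t, s)\<bar> = (\<bar>g (t, s)\<bar> powr q) powr (1 / q)"
      using \<open>q > 1\<close> by (simp add: powr_powr)
    also have "\<dots> \<le> B t s powr (1 / q)"
      unfolding B_def using \<open>q > 1\<close>
      by (intro powr_mono2 coordinated_convex_le_bilinear_interp[OF assms(9) ab cd that]) auto
    finally show ?thesis .
  qed
  have contf: "continuous_on {a..b} (\<lambda>t. f (t, s))" if "s \<in> {c..d}" for s
    using assms(6) that
    by (auto simp: partially_differentiable_fst_on_def continuous_on_eq_continuous_within
        intro: differentiable_imp_continuous_within)
  \<comment> \<open>Differentiability makes the values chosen by \<open>vector_derivative\<close>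
    genuine derivatives, here and in \<open>dert\<close>.\<close>
  have ders: "((\<lambda>v. f (t, v)) has_vector_derivative partial_snd {c..d} f (t, s)) (at s within {c..d})"
    if "t \<in> {a..b}" "s \<in> {c..d}" for t s
    using assms(7) that
    by (simp add: partially_differentiable_snd_on_def partial_snd_def vector_derivative_works)
  have dert: "((\<lambda>u. partial_snd {c..d} f (u, s)) has_vector_derivative g (t, s)) (at t within {a..b})"
    if "t \<in> {a..b}" "s \<in> {c..d}" for t s
    using assms(8) that
    by (simp add: partially_differentiable_fst_on_def g_def mixed_partial_def
        partial_fst_def[of _ "partial_snd {c..d} f"] vector_derivative_works)
  have contG: "continuous_on ({a..b} \<times> {c..d}) (\<lambda>(t, s). B t s powr (1 / q))"
    unfolding B_def case_prod_unfold using \<open>q > 1\<close>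
    by (intro continuous_on_bilinear_interp_powr[OF ab cd] continuous_intros) auto
  \<comment> \<open>Both estimates are free of averaging factors, so the claim is first proved
    multiplied by the area.\<close>
  have "\<bar>(b - a) * (d - c) * ?E\<bar> \<le> (b - a) * (d - c) * ?R"
  proof -
    have "(b - a) * (d - c) * ?E = (b - a) * (d - c) * f ((a + b) / 2, (c + d) / 2)
           + integral {a..b} (\<lambda>x. integral {c..d} (\<lambda>y. f (x, y)))
           - (b - a) * integral {c..d} (\<lambda>y. f ((a + b) / 2, y))
           - (d - c) * integral {a..b} (\<lambda>x. f (x, (c + d) / 2))"
      using ab cd by (simp add: distrib_left[of "(b - a) * (d - c)"]
          right_diff_distrib[of "(b - a) * (d - c)"])
    then show ?thesis
      using order_trans[OF midpoint_deviation_le2[OF ab cd contf ders dert contG bound]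
          tent_integral_bilinear_interp_le[OF ab cd \<open>q > 1\<close> \<open>1 / p + 1 / q = 1\<close>,
            of "\<bar>g (a, c)\<bar> powr q" "\<bar>g (b, c)\<bar> powr q" "\<bar>g (a, d)\<bar> powr q" "\<bar>g (b, d)\<bar> powr q",
            folded B_def]]
      by simp
  qed
  then have "(b - a) * (d - c) * \<bar>?E\<bar> \<le> (b - a) * (d - c) * ?R"
    using ab cd by (simp only: abs_mult) simp
  then show ?thesis
    by (rule mult_left_le_imp_le) (use ab cd in simp)
qed

end
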